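(* Let $\mathfrak k$ be a bundle of ideals on a Lie algebroid $A\Rightarrow M$ and let $(\mathcal C,v)\in\mathcal A(A;\mathfrak k)$ be an IM connection. For any horizontal IM form $(L,l)\in\Omega^1_{im}(A;\mathfrak k)^{\mathrm{Hor}}$ and any $\lambda\in\mathbb R$, $$\Omega^{(\mathcal C,v)+\lambda(L,l)}=\Omega^{(\mathcal C,v)}+\lambda\,D^{(\mathcal C,v)}(L,l)+\lambda^2\,\mathbf c_2(L,l),$$ where the second-order coefficient (homogeneous of degree two and independent of $(\mathcal C,v)$) is given by the map $$\mathbf c_2\colon\Omega^1_{im}(A;\mathfrak k)^{\mathrm{Hor}}\to\Omega^2_{im}(A;\mathfrak k)^{\mathrm{Hor}},\qquad \mathbf c_2(L,l)(\alpha)=-\big(L|_{\mathfrak k}\,\dot\wedge\,L\alpha,\ L|_{\mathfrak k}\cdot l\alpha\big).$$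
   Context: $A\Rightarrow M$ is a Lie algebroid with anchor $\rho$. A bundle of ideals is a vector subbundle $\mathfrak k\subset A$, $\mathfrak k\subset\ker\rho$, with $[\Gamma(A),\Gamma(\mathfrak k)]\subset\Gamma(\mathfrak k)$. $\Omega^q_{im}(A;\mathfrak k)$ is the space of IM forms: pairs $c=(c_0,c_1)$, with $c_0\colon\Gamma(A)\to\Omega^q(M;\mathfrak k)$ $\mathbb R$-linear and $c_1\colon A\to\Lambda^{q-1}T^*M\otimes\mathfrak k$ a bundle map, satisfying $c_0(f\alpha)=fc_0(\alpha)+df\wedge c_1(\alpha)$, $c_0[\alpha,\beta]=\mathcal L^A_\alpha c_0(\beta)-\mathcal L^A_\beta c_0(\alpha)$, $c_1[\alpha,\beta]=\mathcal L^A_\alpha(c_1(\beta))-\iota_{\rho(\beta)}c_0(\alpha)$, $\iota_{\rho(\alpha)}c_1(\beta)=-\iota_{\rho(\beta)}c_1(\alpha)$, where $(\mathcal L^A_\alpha\gamma)(\underline X)=[\alpha,\gamma(\underline X)]-\sum_j\gamma(\dots,[\rho(\alpha),X_j],\dots)$. Write $c(\alpha)=(c_0(\alpha),c_1(\alpha))$. The form $c$ is horizontal if $c_1|_{\mathfrak k}=0$; these form $\Omega^q_{im}(A;\mathfrak k)^{\mathrm{Hor}}$. An IM connection is an IM 1-form $(\mathcal C,v)$ with $v|_{\mathfrak k}=\mathrm{id}_{\mathfrak k}$; the set of these is $\mathcal A(A;\mathfrak k)$. $(\mathcal C,v)$ induces the linear connection $\nabla_X\xi=\mathcal C(\xi)(X)$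 on $\mathfrak k$ and the projection $h=\mathrm{id}-v$ on $A$. For $c=(c_0,c_1)$ of degree $q$ put $(d^\nabla c)_1(\beta)=c_0(\beta)-d^\nabla(c_1(\beta))$ ($C^\infty(M)$-linear in $\beta$). The horizontal exterior covariant derivative is $$(D^{(\mathcal C,v)}c)_0(\alpha)(X_0,\dots,X_q)=(d^\nabla c_0(\alpha))(X_0,\dots,X_q)-\sum_i(-1)^i(d^\nabla c)_1(\mathcal C\alpha(X_i))(X_0,\dots,\widehat{X_i},\dots,X_q),$$ $(D^{(\mathcal C,v)}c)_1(\beta)=(d^\nabla c)_1(h\beta)$. The curvature is $\Omega^{(\mathcal C,v)}=D^{(\mathcal C,v)}(\mathcal C,v)$. For horizontal $(L,l)$ of degree 1, $L|_{\mathfrak k}$ is $C^\infty(M)$-linear; $L|_{\mathfrak k}\cdot l\alpha=L(l(\alpha))\in\Omega^1(M;\mathfrak k)$ and $(L|_{\mathfrak k}\,\dot\wedge\,L\alpha)(X,Y)=L\big(L\alpha(X)\big)(Y)-L\big(L\alpha(Y)\big)(X)$. *)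

theory Defs
  imports "HOL-Analysis.Analysis" "HOL-Library.Function_Algebras"
begin

text \<open>Functions with values in a real vector space form a real vector space; sections, vector
  fields, differential forms and IM forms are all added and scaled pointwise through this instance
  and the product instance.\<close>

instantiation "fun" :: (type, real_vector) real_vector
begin

definition scaleR_fun :: "real \<Rightarrow> ('a \<Rightarrow> 'b) \<Rightarrow> 'a \<Rightarrow> 'b" where
  "scaleR_fun r f = (\<lambda>x. r *\<^sub>R f x)"

instance
  by standard (simp_all add: scaleR_fun_def fun_eq_iff scaleR_add_right scaleR_add_left)

end

section \<open>Smooth manifolds\<close>

text \<open>On an open set of a finite-dimensional space, \<open>Ck_on k\<close> is the usual class of \<open>C\<^sup>k\<close> maps.\<close>

fun Ck_on :: "nat \<Rightarrow> 'e::real_normed_vector set \<Rightarrow> ('e \<Rightarrow> 'f::real_normed_vector) \<Rightarrow> bool" where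
  "Ck_on 0 S f \<longleftrightarrow> continuous_on S f"
| "Ck_on (Suc k) S f \<longleftrightarrow>
     (\<forall>x\<in>S. f differentiable (at x)) \<and> (\<forall>u. Ck_on k S (\<lambda>x. frechet_derivative f (at x) u))"

definition smooth_on :: "'e::real_normed_vector set \<Rightarrow> ('e \<Rightarrow> 'f::real_normed_vector) \<Rightarrow> bool" where
  "smooth_on S f \<longleftrightarrow> (\<forall>k. Ck_on k S f)"

text \<open>The manifold is the whole type \<open>'m\<close>. The model space \<open>'e\<close> is an arbitrary
  finite-dimensional normed space; class \<open>euclidean_space\<close> is avoided because it excludes
  dimension 0.\<close>

type_synonym ('m, 'e) charts = "('m set \<times> ('m \<Rightarrow> 'e)) set"

definition smooth_atlas ::
    "('m::{t2_space, second_countable_topology}, 'e::real_normed_vector) charts \<Rightarrow> bool" where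
  "smooth_atlas At \<longleftrightarrow>
     (\<exists>B::'e set. finite B \<and> span B = UNIV) \<and>
     (\<Union>(U, \<phi>)\<in>At. U) = UNIV \<and>
     (\<forall>(U, \<phi>)\<in>At. open U \<and> open (\<phi> ` U) \<and> (\<exists>\<psi>. homeomorphism U (\<phi> ` U) \<phi> \<psi>)) \<and>
     (\<forall>(U, \<phi>)\<in>At. \<forall>(V, \<psi>)\<in>At. smooth_on (\<phi> ` (U \<inter> V)) (\<psi> \<circ> inv_into U \<phi>))"

definition smooth_fun_on ::
    "('m, 'e::real_normed_vector) charts \<Rightarrow> 'm set \<Rightarrow> ('m \<Rightarrow> real) \<Rightarrow> bool" where
  "smooth_fun_on At W f \<longleftrightarrow> (\<forall>(U, \<phi>)\<in>At. smooth_on (\<phi> ` (U \<inter> W)) (f \<circ> inv_into U \<phi>))"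

definition Cinf :: "('m, 'e::real_normed_vector) charts \<Rightarrow> ('m \<Rightarrow> real) set" where
  "Cinf At = {f. smooth_fun_on At UNIV f}"

text \<open>Multiplication of a section, vector field or any other pointwise object by a function.\<close>

definition fmul :: "('m \<Rightarrow> real) \<Rightarrow> ('m \<Rightarrow> 'b::real_vector) \<Rightarrow> 'm \<Rightarrow> 'b" (infixr "\<odot>" 75) where
  "f \<odot> s = (\<lambda>x. f x *\<^sub>R s x)"

text \<open>\<open>T\<^sub>xM\<close> consists of the derivations of \<open>C\<^sup>\<infinity>(M)\<close> at \<open>x\<close>. They are set to 0 on non-smooth
  functions, so that equality in HOL is equality of tangent vectors.\<close>

type_synonym 'm tvec = "('m \<Rightarrow> real) \<Rightarrow> real"
type_synonym 'm vfield = "'m \<Rightarrow> 'm tvec"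

definition tangent :: "('m, 'e::real_normed_vector) charts \<Rightarrow> 'm \<Rightarrow> 'm tvec set" where
  "tangent At x = {u.
     (\<forall>f\<in>Cinf At. \<forall>g\<in>Cinf At. \<forall>a b::real. u (a *\<^sub>R f + b *\<^sub>R g) = a * u f + b * u g) \<and>
     (\<forall>f\<in>Cinf At. \<forall>g\<in>Cinf At. u (f * g) = f x * u g + g x * u f) \<and>
     (\<forall>f. f \<notin> Cinf At \<longrightarrow> u f = 0)}"

definition vapp :: "'m vfield \<Rightarrow> ('m \<Rightarrow> real) \<Rightarrow> 'm \<Rightarrow> real" where
  "vapp X f = (\<lambda>x. X x f)"

definition vfields :: "('m, 'e::real_normed_vector) charts \<Rightarrow> 'm vfield set" where
  "vfields At = {X. (\<forall>x. X x \<in> tangent At x) \<and> (\<forall>f\<in>Cinf At. vapp X f \<in> Cinf At)}"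

definition vbracket ::
    "('m, 'e::real_normed_vector) charts \<Rightarrow> 'm vfield \<Rightarrow> 'm vfield \<Rightarrow> 'm vfield" where
  "vbracket At X Y = (\<lambda>x f. if f \<in> Cinf At then X x (vapp Y f) - Y x (vapp X f) else 0)"

section \<open>Lie algebroids and bundles of ideals\<close>

text \<open>A vector bundle is a family of vector spaces \<open>fibre A x\<close> with local trivializations having
  smooth transition functions. A local trivialization over \<open>U\<close> is the same as a local frame over
  \<open>U\<close>, and is recorded as such: \<open>(U, e) \<in> frames A\<close>, with \<open>e i\<close> for \<open>i < rk A\<close> the members of the
  frame. The fibres are subspaces of one real vector space type \<open>'a\<close>, which carries no topology;
  since every family of vector spaces of equal dimension arises like this, the bundle need not be
  trivial. The bracket matters only on smooth sections, the anchor only on the fibres.\<close>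

record ('m, 'e, 'a) algebroid =
  charts :: "('m, 'e) charts"
  fibre :: "'m \<Rightarrow> 'a set"
  rk :: nat
  frames :: "('m set \<times> (nat \<Rightarrow> 'm \<Rightarrow> 'a)) set"
  bracket :: "('m \<Rightarrow> 'a) \<Rightarrow> ('m \<Rightarrow> 'a) \<Rightarrow> 'm \<Rightarrow> 'a"
  anchor :: "'m \<Rightarrow> 'a \<Rightarrow> 'm tvec"

definition is_basis :: "nat \<Rightarrow> (nat \<Rightarrow> 'a::real_vector) \<Rightarrow> 'a set \<Rightarrow> bool" where
  "is_basis r b S \<longleftrightarrow> inj_on b {..<r} \<and> independent (b ` {..<r}) \<and> span (b ` {..<r}) = S"

definition smooth_section_on ::
    "('m, 'e::real_normed_vector, 'a::real_vector) algebroid \<Rightarrow> 'm set \<Rightarrow> ('m \<Rightarrow> 'a) \<Rightarrow> bool" where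
  "smooth_section_on A W s \<longleftrightarrow>
     (\<forall>x\<in>W. s x \<in> fibre A x) \<and>
     (\<forall>(U, e)\<in>frames A. \<exists>g. (\<forall>i<rk A. smooth_fun_on (charts A) (U \<inter> W) (g i)) \<and>
        (\<forall>x\<in>U \<inter> W. s x = (\<Sum>i<rk A. g i x *\<^sub>R e i x)))"

definition vector_bundle ::
    "('m::{t2_space, second_countable_topology}, 'e::real_normed_vector, 'a::real_vector) algebroid
      \<Rightarrow> bool" where
  "vector_bundle A \<longleftrightarrow>
     smooth_atlas (charts A) \<and>
     (\<Union>(U, e)\<in>frames A. U) = UNIV \<and>
     (\<forall>(U, e)\<in>frames A. open U \<and>
        (\<forall>x\<in>U. is_basis (rk A) (\<lambda>i. e i x) (fibre A x)) \<and>
        (\<forall>i<rk A. smooth_section_on A U (e i)))"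

definition sections ::
    "('m, 'e::real_normed_vector, 'a::real_vector) algebroid \<Rightarrow> ('m \<Rightarrow> 'a) set" where
  "sections A = {s. smooth_section_on A UNIV s}"

definition rho ::
    "('m, 'e::real_normed_vector, 'a::real_vector) algebroid \<Rightarrow> ('m \<Rightarrow> 'a) \<Rightarrow> 'm vfield" where
  "rho A \<alpha> = (\<lambda>x. anchor A x (\<alpha> x))"

definition lie_algebroid ::
    "('m::{t2_space, second_countable_topology}, 'e::real_normed_vector, 'a::real_vector) algebroid
      \<Rightarrow> bool" where
  "lie_algebroid A \<longleftrightarrow>
     vector_bundle A \<and>
     (\<forall>x. \<forall>a\<in>fibre A x. anchor A x a \<in> tangent (charts A) x) \<and>
     (\<forall>x. \<forall>a\<in>fibre A x. \<forall>b\<in>fibre A x. \<forall>s t::real.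
        anchor A x (s *\<^sub>R a + t *\<^sub>R b) = s *\<^sub>R anchor A x a + t *\<^sub>R anchor A x b) \<and>
     (\<forall>\<alpha>\<in>sections A. rho A \<alpha> \<in> vfields (charts A)) \<and>
     (\<forall>\<alpha>\<in>sections A. \<forall>\<beta>\<in>sections A. bracket A \<alpha> \<beta> \<in> sections A) \<and>
     (\<forall>\<alpha>\<in>sections A. \<forall>\<beta>\<in>sections A. bracket A \<alpha> \<beta> = - bracket A \<beta> \<alpha>) \<and>
     (\<forall>\<alpha>\<in>sections A. \<forall>\<beta>\<in>sections A. \<forall>\<gamma>\<in>sections A. \<forall>s t::real.
        bracket A \<alpha> (s *\<^sub>R \<beta> + t *\<^sub>R \<gamma>) = s *\<^sub>R bracket A \<alpha> \<beta> + t *\<^sub>R bracket A \<alpha> \<gamma>) \<and>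
     (\<forall>\<alpha>\<in>sections A. \<forall>\<beta>\<in>sections A. \<forall>\<gamma>\<in>sections A.
        bracket A \<alpha> (bracket A \<beta> \<gamma>) + bracket A \<beta> (bracket A \<gamma> \<alpha>)
          + bracket A \<gamma> (bracket A \<alpha> \<beta>) = 0) \<and>
     (\<forall>\<alpha>\<in>sections A. \<forall>\<beta>\<in>sections A. \<forall>f\<in>Cinf (charts A).
        bracket A \<alpha> (f \<odot> \<beta>) = f \<odot> bracket A \<alpha> \<beta> + vapp (rho A \<alpha>) f \<odot> \<beta>) \<and>
     (\<forall>\<alpha>\<in>sections A. \<forall>\<beta>\<in>sections A.
        rho A (bracket A \<alpha> \<beta>) = vbracket (charts A) (rho A \<alpha>) (rho A \<beta>))"

definition vector_subbundle ::
    "('m::topological_space, 'e::real_normed_vector, 'a::real_vector) algebroid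
      \<Rightarrow> ('m \<Rightarrow> 'a set) \<Rightarrow> bool" where
  "vector_subbundle A \<kk> \<longleftrightarrow>
     (\<exists>r. \<forall>x. \<exists>U e. open U \<and> x \<in> U \<and>
        (\<forall>i<r. smooth_section_on A U (e i)) \<and>
        (\<forall>y\<in>U. is_basis r (\<lambda>i. e i y) (\<kk> y)))"

definition subsections ::
    "('m, 'e::real_normed_vector, 'a::real_vector) algebroid \<Rightarrow> ('m \<Rightarrow> 'a set)
      \<Rightarrow> ('m \<Rightarrow> 'a) set" where
  "subsections A \<kk> = {s \<in> sections A. \<forall>x. s x \<in> \<kk> x}"

definition bundle_of_ideals ::
    "('m::topological_space, 'e::real_normed_vector, 'a::real_vector) algebroid
      \<Rightarrow> ('m \<Rightarrow> 'a set) \<Rightarrow> bool" where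
  "bundle_of_ideals A \<kk> \<longleftrightarrow>
     vector_subbundle A \<kk> \<and>
     (\<forall>x. \<forall>a\<in>\<kk> x. anchor A x a = 0) \<and>
     (\<forall>\<alpha>\<in>sections A. \<forall>\<xi>\<in>subsections A \<kk>. bracket A \<alpha> \<xi> \<in> subsections A \<kk>)"

section \<open>Differential forms with values in a bundle of ideals\<close>

text \<open>A \<open>q\<close>-form is an alternating \<open>C\<^sup>\<infinity>(M)\<close>-multilinear map on \<open>q\<close>-tuples of vector fields, with
  values in \<open>\<Gamma>(\<kk>)\<close>. It is a function on lists that vanishes on every list which is not a \<open>q\<close>-tuple
  of vector fields, so that equality in HOL is equality of forms. A 0-form is given by its value on
  the empty list.\<close>

type_synonym ('m, 'a) form = "'m vfield list \<Rightarrow> 'm \<Rightarrow> 'a"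

definition Omega ::
    "('m, 'e::real_normed_vector, 'a::real_vector) algebroid \<Rightarrow> ('m \<Rightarrow> 'a set) \<Rightarrow> nat
      \<Rightarrow> ('m, 'a) form set" where
  "Omega A \<kk> q = {\<omega>.
     (\<forall>Xs. length Xs = q \<and> set Xs \<subseteq> vfields (charts A) \<longrightarrow> \<omega> Xs \<in> subsections A \<kk>) \<and>
     (\<forall>Xs. \<not> (length Xs = q \<and> set Xs \<subseteq> vfields (charts A)) \<longrightarrow> \<omega> Xs = 0) \<and>
     (\<forall>Xs i. \<forall>X\<in>vfields (charts A). \<forall>Y\<in>vfields (charts A).
        \<forall>f\<in>Cinf (charts A). \<forall>g\<in>Cinf (charts A).
        length Xs = q \<and> set Xs \<subseteq> vfields (charts A) \<and> i < q \<longrightarrow>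
          \<omega> (Xs[i := f \<odot> X + g \<odot> Y]) = f \<odot> \<omega> (Xs[i := X]) + g \<odot> \<omega> (Xs[i := Y])) \<and>
     (\<forall>Xs i j. length Xs = q \<and> set Xs \<subseteq> vfields (charts A) \<and> i < j \<and> j < q \<and> Xs ! i = Xs ! j
        \<longrightarrow> \<omega> Xs = 0)}"

definition fform :: "('m \<Rightarrow> real) \<Rightarrow> ('m, 'a::real_vector) form \<Rightarrow> ('m, 'a) form" where
  "fform f \<omega> = (\<lambda>Xs. f \<odot> \<omega> Xs)"

definition interior_prod :: "'m vfield \<Rightarrow> ('m, 'a) form \<Rightarrow> ('m, 'a) form" where
  "interior_prod X \<omega> = (\<lambda>Xs. \<omega> (X # Xs))"

definition omit :: "nat \<Rightarrow> 'b list \<Rightarrow> 'b list" where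
  "omit i Xs = take i Xs @ drop (Suc i) Xs"

text \<open>\<open>df \<and> \<omega>\<close>, with the normalization \<open>(df \<and> \<omega>)(X, Y) = df(X) \<omega>(Y) - df(Y) \<omega>(X)\<close>.\<close>

definition d_wedge ::
    "('m, 'e::real_normed_vector, 'a::real_vector) algebroid \<Rightarrow> ('m \<Rightarrow> real)
      \<Rightarrow> ('m, 'a) form \<Rightarrow> ('m, 'a) form" where
  "d_wedge A f \<omega> = (\<lambda>Xs. if set Xs \<subseteq> vfields (charts A)
     then \<Sum>i<length Xs. (-1) ^ i *\<^sub>R (vapp (Xs ! i) f \<odot> \<omega> (omit i Xs)) else 0)"

definition lie_der ::
    "('m, 'e::real_normed_vector, 'a::real_vector) algebroid \<Rightarrow> ('m \<Rightarrow> 'a)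
      \<Rightarrow> ('m, 'a) form \<Rightarrow> ('m, 'a) form" where
  "lie_der A \<alpha> \<gamma> = (\<lambda>Xs. if set Xs \<subseteq> vfields (charts A)
     then bracket A \<alpha> (\<gamma> Xs)
       - (\<Sum>j<length Xs. \<gamma> (Xs[j := vbracket (charts A) (rho A \<alpha>) (Xs ! j)])) else 0)"

text \<open>Exterior covariant derivative of a connection \<open>\<nabla>\<close>, by the Koszul formula
  \<open>\<Sum>\<^sub>i (-1)\<^sup>i \<nabla>\<^bsub>X i\<^esub> (\<omega>(\<dots>)) + \<Sum>\<^bsub>i<j\<^esub> (-1)\<^bsup>i+j\<^esup> \<omega>([X i, X j], \<dots>)\<close>, the used entries being omitted.\<close>

definition dnabla ::
    "('m, 'e::real_normed_vector, 'a::real_vector) algebroid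
      \<Rightarrow> ('m vfield \<Rightarrow> ('m \<Rightarrow> 'a) \<Rightarrow> 'm \<Rightarrow> 'a) \<Rightarrow> ('m, 'a) form \<Rightarrow> ('m, 'a) form" where
  "dnabla A nab \<omega> = (\<lambda>Xs. if set Xs \<subseteq> vfields (charts A)
     then (\<Sum>i<length Xs. (-1) ^ i *\<^sub>R nab (Xs ! i) (\<omega> (omit i Xs)))
        + (\<Sum>j<length Xs. \<Sum>i<j. (-1) ^ (i + j) *\<^sub>R
             \<omega> (vbracket (charts A) (Xs ! i) (Xs ! j) # omit i (omit j Xs)))
     else 0)"

section \<open>IM forms\<close>

text \<open>Both components act on sections of \<open>A\<close>; the bundle map \<open>c\<^sub>1\<close> is the corresponding
  \<open>C\<^sup>\<infinity>(M)\<close>-linear map on sections. Both are 0 off \<open>\<Gamma>(A)\<close>, so that equality in HOL is equality of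
  IM forms. In degree 0, the component \<open>c\<^sub>1\<close> vanishes.\<close>

type_synonym ('m, 'a) im_form =
  "(('m \<Rightarrow> 'a) \<Rightarrow> ('m, 'a) form) \<times> (('m \<Rightarrow> 'a) \<Rightarrow> ('m, 'a) form)"

definition im_forms ::
    "('m, 'e::real_normed_vector, 'a::real_vector) algebroid \<Rightarrow> ('m \<Rightarrow> 'a set) \<Rightarrow> nat
      \<Rightarrow> ('m, 'a) im_form set" where
  "im_forms A \<kk> q = {(c0, c1).
     (\<forall>\<alpha>\<in>sections A. c0 \<alpha> \<in> Omega A \<kk> q) \<and>
     (\<forall>\<alpha>\<in>sections A. c1 \<alpha> \<in> (if q = 0 then {0} else Omega A \<kk> (q - 1))) \<and>
     (\<forall>\<alpha>. \<alpha> \<notin> sections A \<longrightarrow> c0 \<alpha> = 0 \<and> c1 \<alpha> = 0) \<and>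
     (\<forall>\<alpha>\<in>sections A. \<forall>\<beta>\<in>sections A. \<forall>s t::real.
        c0 (s *\<^sub>R \<alpha> + t *\<^sub>R \<beta>) = s *\<^sub>R c0 \<alpha> + t *\<^sub>R c0 \<beta>) \<and>
     (\<forall>\<alpha>\<in>sections A. \<forall>\<beta>\<in>sections A. \<forall>f\<in>Cinf (charts A). \<forall>g\<in>Cinf (charts A).
        c1 (f \<odot> \<alpha> + g \<odot> \<beta>) = fform f (c1 \<alpha>) + fform g (c1 \<beta>)) \<and>
     (\<forall>\<alpha>\<in>sections A. \<forall>f\<in>Cinf (charts A).
        c0 (f \<odot> \<alpha>) = fform f (c0 \<alpha>) + d_wedge A f (c1 \<alpha>)) \<and>
     (\<forall>\<alpha>\<in>sections A. \<forall>\<beta>\<in>sections A.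
        c0 (bracket A \<alpha> \<beta>) = lie_der A \<alpha> (c0 \<beta>) - lie_der A \<beta> (c0 \<alpha>)) \<and>
     (\<forall>\<alpha>\<in>sections A. \<forall>\<beta>\<in>sections A.
        c1 (bracket A \<alpha> \<beta>) = lie_der A \<alpha> (c1 \<beta>) - interior_prod (rho A \<beta>) (c0 \<alpha>)) \<and>
     (\<forall>\<alpha>\<in>sections A. \<forall>\<beta>\<in>sections A.
        interior_prod (rho A \<alpha>) (c1 \<beta>) = - interior_prod (rho A \<beta>) (c1 \<alpha>))}"

definition hor_im_forms ::
    "('m, 'e::real_normed_vector, 'a::real_vector) algebroid \<Rightarrow> ('m \<Rightarrow> 'a set) \<Rightarrow> nat
      \<Rightarrow> ('m, 'a) im_form set" where
  "hor_im_forms A \<kk> q = {(c0, c1) \<in> im_forms A \<kk> q. \<forall>\<xi>\<in>subsections A \<kk>. c1 \<xi> = 0}"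

definition im_connections ::
    "('m, 'e::real_normed_vector, 'a::real_vector) algebroid \<Rightarrow> ('m \<Rightarrow> 'a set)
      \<Rightarrow> ('m, 'a) im_form set" where
  "im_connections A \<kk> = {(C, v) \<in> im_forms A \<kk> 1. \<forall>\<xi>\<in>subsections A \<kk>. v \<xi> [] = \<xi>}"

definition nabla :: "('m, 'a) im_form \<Rightarrow> 'm vfield \<Rightarrow> ('m \<Rightarrow> 'a) \<Rightarrow> 'm \<Rightarrow> 'a" where
  "nabla Cv X \<xi> = fst Cv \<xi> [X]"

definition hproj :: "('m, 'a::real_vector) im_form \<Rightarrow> ('m \<Rightarrow> 'a) \<Rightarrow> 'm \<Rightarrow> 'a" where
  "hproj Cv \<beta> = \<beta> - snd Cv \<beta> []"

definition dnabla1 ::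
    "('m, 'e::real_normed_vector, 'a::real_vector) algebroid \<Rightarrow> ('m, 'a) im_form
      \<Rightarrow> ('m, 'a) im_form \<Rightarrow> ('m \<Rightarrow> 'a) \<Rightarrow> ('m, 'a) form" where
  "dnabla1 A Cv c \<beta> = fst c \<beta> - dnabla A (nabla Cv) (snd c \<beta>)"

definition hor_ext_der ::
    "('m, 'e::real_normed_vector, 'a::real_vector) algebroid \<Rightarrow> ('m, 'a) im_form
      \<Rightarrow> ('m, 'a) im_form \<Rightarrow> ('m, 'a) im_form" where
  "hor_ext_der A Cv c =
     ((\<lambda>\<alpha> Xs. dnabla A (nabla Cv) (fst c \<alpha>) Xs
         - (\<Sum>i<length Xs. (-1) ^ i *\<^sub>R dnabla1 A Cv c (fst Cv \<alpha> [Xs ! i]) (omit i Xs))),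
      (\<lambda>\<beta>. dnabla1 A Cv c (hproj Cv \<beta>)))"

definition curvature ::
    "('m, 'e::real_normed_vector, 'a::real_vector) algebroid \<Rightarrow> ('m, 'a) im_form
      \<Rightarrow> ('m, 'a) im_form" where
  "curvature A Cv = hor_ext_der A Cv Cv"

section \<open>The second-order coefficient\<close>

definition dot :: "(('m \<Rightarrow> 'a) \<Rightarrow> ('m, 'a) form) \<Rightarrow> ('m, 'a) form \<Rightarrow> ('m, 'a) form" where
  "dot L \<eta> = L (\<eta> [])"

definition dot_wedge ::
    "(('m \<Rightarrow> 'a::real_vector) \<Rightarrow> ('m, 'a) form) \<Rightarrow> ('m, 'a) form \<Rightarrow> ('m, 'a) form" where
  "dot_wedge L \<eta> = (\<lambda>Xs. case Xs of [X, Y] \<Rightarrow> L (\<eta> [X]) [Y] - L (\<eta> [Y]) [X] | _ \<Rightarrow> 0)"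

definition c2 :: "('m, 'a::real_vector) im_form \<Rightarrow> ('m, 'a) im_form" where
  "c2 = (\<lambda>(L, l). (\<lambda>\<alpha>. - dot_wedge L (L \<alpha>), \<lambda>\<alpha>. - dot L (l \<alpha>)))"

end

theory Submission
  imports Defs
begin

text \<open>
  Everything rests on two facts about the restriction of a form to \<open>\<Gamma>(\<kk>)\<close>. If \<open>(C, v)\<close> is an IM
  connection then \<open>v\<close> is the identity on \<open>\<Gamma>(\<kk>)\<close>, so \<open>d\<^sup>\<nabla> (v \<xi>) = \<nabla>\<xi> = C \<xi>\<close> there and the correction
  term \<open>(d\<^sup>\<nabla> (C, v))\<^sub>1\<close> vanishes on \<open>\<Gamma>(\<kk>)\<close>. If \<open>(L, l)\<close> is horizontal then \<open>l\<close> vanishes on \<open>\<Gamma>(\<kk>)\<close>,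
  so \<open>L\<close> is \<open>C\<^sup>\<infinity>(M)\<close>-linear there.

  Both \<open>C\<close> and \<open>C + \<lambda> L\<close> are the first component of a pair whose second component is the identity
  on \<open>\<Gamma>(\<kk>)\<close>. The components of the curvature are then \<open>d\<^sup>\<nabla> (C \<alpha>)\<close> and \<open>C (h \<beta>)\<close>. Replacing \<open>C\<close> by
  \<open>C + \<lambda> L\<close> changes \<open>\<nabla>\<close> by \<open>\<lambda> L\<close> on \<open>\<Gamma>(\<kk>)\<close> and \<open>h \<beta>\<close> by \<open>- \<lambda> l \<beta>\<close>, and expanding in powers of \<open>\<lambda>\<close> gives
  the stated polynomial (\<open>curvature_expansion\<close>): the terms with one factor from \<open>(L, l)\<close> assemble to
  \<open>D (L, l)\<close>, and the quadratic terms apply \<open>L\<close> to a value of \<open>L\<close> or \<open>l\<close>.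

  That \<open>c2 (L, l)\<close> is again an IM form is verified on vector fields. Two consequences of the IM
  equations with one argument \<open>\<xi> \<in> \<Gamma>(\<kk>)\<close>, where \<open>\<rho> \<xi> = 0\<close> and \<open>l \<xi> = 0\<close>, carry the computation:
  \<open>L [\<alpha>, \<xi>] (X) = [\<alpha>, L \<xi> (X)] - L \<xi> ([\<rho> \<alpha>, X]) - [\<xi>, L \<alpha> (X)]\<close> (\<open>L_bracket_ideal\<close>) and
  \<open>[l \<beta>, \<xi>] = - L \<xi> (\<rho> \<beta>)\<close> (\<open>bracket_l_value\<close>). In the equation for \<open>[\<alpha>, \<beta>]\<close> the first leaves
  brackets of two values \<open>L \<beta> (X)\<close> and \<open>L \<alpha> (Y)\<close>, which cancel after antisymmetrization in
  \<open>X\<close> and \<open>Y\<close>; the second turns the remaining brackets with \<open>l \<beta>\<close> into the required contractions.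

  Subtraction and multiplication by functions must preserve sections for any of this to make
  sense, so the development starts from the closure of smooth functions under sum and product.
\<close>

section \<open>Smooth functions\<close>

lemma Ck_on_subset: "Ck_on k S f \<Longrightarrow> T \<subseteq> S \<Longrightarrow> Ck_on k T f"
  by (induction k arbitrary: f) (auto intro: continuous_on_subset)

text \<open>Openness is essential: differentiability at a point of \<open>S\<close> refers to a whole neighbourhood.\<close>

lemma Ck_on_cong:
  assumes "open S" "\<And>x. x \<in> S \<Longrightarrow> f x = g x" "Ck_on k S f"
  shows "Ck_on k S g"
  using assms(2,3)
proof (induction k arbitrary: f g)
  case 0
  then show ?case using continuous_on_cong by fastforce
next
  case (Suc k)
  have der: "(g has_derivative frechet_derivative f (at x)) (at x)" if "x \<in> S" for x
  proof (rule has_derivative_transform_within_open[OF _ \<open>open S\<close> that])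
    show "(f has_derivative frechet_derivative f (at x)) (at x)"
      using Suc.prems(2) that by (simp add: frechet_derivative_works)
  qed (use Suc.prems(1) in auto)
  then have "frechet_derivative f (at x) u = frechet_derivative g (at x) u" if "x \<in> S" for x u
    using frechet_derivative_at[OF der[OF that]] by simp
  then have "Ck_on k S (\<lambda>x. frechet_derivative g (at x) u)" for u
    using Suc.IH[of "\<lambda>x. frechet_derivative f (at x) u" "\<lambda>x. frechet_derivative g (at x) u"] Suc.prems(2)
    by simp
  then show ?case using der by (auto simp: differentiable_def)
qed

lemma Ck_on_Suc_imp: "Ck_on (Suc k) S f \<Longrightarrow> Ck_on k S f"
proof (induction k arbitrary: f)
  case 0
  then show ?case
    by (auto intro!: continuous_at_imp_continuous_on differentiable_imp_continuous_within)
next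
  case (Suc k)
  then show ?case by (metis Ck_on.simps(2))
qed

lemma Ck_on_add:
  assumes "open S" "Ck_on k S f" "Ck_on k S g"
  shows "Ck_on k S (\<lambda>x. f x + g x)"
  using assms(2,3)
proof (induction k arbitrary: f g)
  case 0
  then show ?case by (simp add: continuous_on_add)
next
  case (Suc k)
  have "Ck_on k S (\<lambda>x. frechet_derivative (\<lambda>x. f x + g x) (at x) u)" for u
  proof (rule Ck_on_cong[OF \<open>open S\<close>])
    show "Ck_on k S (\<lambda>x. frechet_derivative f (at x) u + frechet_derivative g (at x) u)"
      using Suc by simp
    fix x assume "x \<in> S"
    then have "((\<lambda>x. f x + g x) has_derivative
        (\<lambda>u. frechet_derivative f (at x) u + frechet_derivative g (at x) u)) (at x)"
      using Suc.prems by (intro has_derivative_add) (auto simp: frechet_derivative_works[symmetric])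
    from frechet_derivative_at[OF this]
    show "frechet_derivative f (at x) u + frechet_derivative g (at x) u
        = frechet_derivative (\<lambda>x. f x + g x) (at x) u"
      by metis
  qed
  then show ?case using Suc.prems by auto
qed

lemma Ck_on_mult:
  fixes f g :: "'e::real_normed_vector \<Rightarrow> real"
  assumes "open S" "Ck_on k S f" "Ck_on k S g"
  shows "Ck_on k S (\<lambda>x. f x * g x)"
  using assms(2,3)
proof (induction k arbitrary: f g)
  case 0
  then show ?case by (simp add: continuous_on_mult)
next
  case (Suc k)
  have "Ck_on k S (\<lambda>x. frechet_derivative (\<lambda>x. f x * g x) (at x) u)" for u
  proof (rule Ck_on_cong[OF \<open>open S\<close>])
    show "Ck_on k S (\<lambda>x. f x * frechet_derivative g (at x) u + frechet_derivative f (at x) u * g x)"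
      using Suc.prems Ck_on_Suc_imp[OF Suc.prems(1)] Ck_on_Suc_imp[OF Suc.prems(2)]
      by (intro Ck_on_add[OF \<open>open S\<close>] Suc.IH) auto
    fix x assume "x \<in> S"
    then have "((\<lambda>x. f x * g x) has_derivative
        (\<lambda>u. f x * frechet_derivative g (at x) u + frechet_derivative f (at x) u * g x)) (at x)"
      using Suc.prems by (intro has_derivative_mult) (auto simp: frechet_derivative_works[symmetric])
    from frechet_derivative_at[OF this]
    show "f x * frechet_derivative g (at x) u + frechet_derivative f (at x) u * g x
        = frechet_derivative (\<lambda>x. f x * g x) (at x) u"
      by metis
  qed
  then show ?case using Suc.prems by auto
qed

lemma Ck_on_const: "Ck_on k S (\<lambda>x. c)"
  by (induction k arbitrary: c) (auto simp: frechet_derivative_const)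

text \<open>Domains of coordinate representations are open, so that the closure properties of \<open>Ck_on\<close> apply
  to them.\<close>

lemma open_chart_image:
  assumes "smooth_atlas At" "(U, \<phi>) \<in> At" "open W"
  shows "open (\<phi> ` (U \<inter> W))"
proof -
  obtain \<psi> where "open U" "open (\<phi> ` U)" "homeomorphism U (\<phi> ` U) \<phi> \<psi>"
    using assms(1,2) unfolding smooth_atlas_def by blast
  then show ?thesis
    using homeomorphism_imp_open_map[of U "\<phi> ` U" \<phi> \<psi> "U \<inter> W"] assms(3)
    by (metis open_openin_trans openin_open_Int openin_open_trans)
qed

lemma smooth_fun_on_add:
  assumes "smooth_atlas At" "open W" "smooth_fun_on At W f" "smooth_fun_on At W g"
  shows "smooth_fun_on At W (\<lambda>x. f x + g x)"
  using assms open_chart_image[OF assms(1) _ assms(2)]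
  by (fastforce simp: smooth_fun_on_def smooth_on_def comp_def intro: Ck_on_add)

lemma smooth_fun_on_mult:
  assumes "smooth_atlas At" "open W" "smooth_fun_on At W f" "smooth_fun_on At W g"
  shows "smooth_fun_on At W (\<lambda>x. f x * g x)"
  using assms open_chart_image[OF assms(1) _ assms(2)]
  by (fastforce simp: smooth_fun_on_def smooth_on_def comp_def intro: Ck_on_mult)

lemma smooth_fun_on_subset: "smooth_fun_on At W f \<Longrightarrow> V \<subseteq> W \<Longrightarrow> smooth_fun_on At V f"
  unfolding smooth_fun_on_def smooth_on_def
  by (fast intro: Ck_on_subset)

lemma const_in_Cinf: "(\<lambda>x. c) \<in> Cinf At"
  by (auto simp: Cinf_def smooth_fun_on_def smooth_on_def comp_def Ck_on_const)

lemma scaleR_fun_apply: "(r *\<^sub>R f) x = r *\<^sub>R f x"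
  by (simp add: scaleR_fun_def)

lemma const_fmul: "(\<lambda>x. c) \<odot> s = c *\<^sub>R s"
  by (simp add: fmul_def scaleR_fun_def)

lemma length_2E:
  assumes "length xs = 2"
  obtains x y where "xs = [x, y]"
  using assms by (auto simp: numeral_2_eq_2 length_Suc_conv)

section \<open>Sections and brackets\<close>

locale ideal_bundle =
  fixes A :: "('m::{t2_space, second_countable_topology}, 'e::real_normed_vector, 'a::real_vector) algebroid"
    and \<kk> :: "'m \<Rightarrow> 'a set"
  assumes lie_algebroid: "lie_algebroid A"
    and bundle_of_ideals: "bundle_of_ideals A \<kk>"
begin

abbreviation "\<Gamma> \<equiv> sections A"
abbreviation "\<Gamma>k \<equiv> subsections A \<kk>"
abbreviation "VF \<equiv> vfields (charts A)"
abbreviation "br \<equiv> bracket A"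

lemma vector_bundle: "vector_bundle A" and atlas: "smooth_atlas (charts A)"
  using lie_algebroid by (auto simp: lie_algebroid_def vector_bundle_def)

lemma is_basis_subspace: "is_basis r b S \<Longrightarrow> subspace S"
  unfolding is_basis_def using subspace_span by blast

lemma subspace_fibre: "subspace (fibre A x)"
proof -
  obtain U e where "(U, e) \<in> frames A" "x \<in> U"
    using vector_bundle unfolding vector_bundle_def by blast
  then show ?thesis
    using vector_bundle is_basis_subspace unfolding vector_bundle_def by fast
qed

lemma subspace_ideal: "subspace (\<kk> x)"
  using bundle_of_ideals is_basis_subspace unfolding bundle_of_ideals_def vector_subbundle_def
  by metis

lemma section_add:
  assumes "s \<in> \<Gamma>" "t \<in> \<Gamma>" shows "s + t \<in> \<Gamma>"
  unfolding sections_def smooth_section_on_def mem_Collect_eq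
proof (intro conjI ballI, unfold Int_UNIV_right)
  show "(s + t) x \<in> fibre A x" for x
    using assms by (auto simp: sections_def smooth_section_on_def intro: subspace_add subspace_fibre)
next
  fix F assume "F \<in> frames A"
  then obtain U e where F: "F = (U, e)" "(U, e) \<in> frames A" by (cases F) auto
  obtain g where g: "\<forall>i<rk A. smooth_fun_on (charts A) U (g i)"
      "\<forall>x\<in>U. s x = (\<Sum>i<rk A. g i x *\<^sub>R e i x)"
    using assms(1) F(2) unfolding sections_def smooth_section_on_def by fastforce
  obtain h where h: "\<forall>i<rk A. smooth_fun_on (charts A) U (h i)"
      "\<forall>x\<in>U. t x = (\<Sum>i<rk A. h i x *\<^sub>R e i x)"
    using assms(2) F(2) unfolding sections_def smooth_section_on_def by fastforce
  have "open U" using vector_bundle F(2) unfolding vector_bundle_def by blast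
  then have "\<exists>g. (\<forall>i<rk A. smooth_fun_on (charts A) U (g i)) \<and>
      (\<forall>x\<in>U. (s + t) x = (\<Sum>i<rk A. g i x *\<^sub>R e i x))"
    using g h
    by (intro exI[of _ "\<lambda>i x. g i x + h i x"])
      (auto simp: scaleR_add_left sum.distrib intro: smooth_fun_on_add atlas)
  then show "case F of (U, e) \<Rightarrow> \<exists>g. (\<forall>i<rk A. smooth_fun_on (charts A) U (g i)) \<and>
      (\<forall>x\<in>U. (s + t) x = (\<Sum>i<rk A. g i x *\<^sub>R e i x))"
    using F(1) by simp
qed

lemma section_fmul:
  assumes "f \<in> Cinf (charts A)" "s \<in> \<Gamma>" shows "f \<odot> s \<in> \<Gamma>"
  unfolding sections_def smooth_section_on_def mem_Collect_eq
proof (intro conjI ballI, unfold Int_UNIV_right)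
  show "(f \<odot> s) x \<in> fibre A x" for x
    using assms
    by (auto simp: sections_def smooth_section_on_def fmul_def intro: subspace_scale subspace_fibre)
next
  fix F assume "F \<in> frames A"
  then obtain U e where F: "F = (U, e)" "(U, e) \<in> frames A" by (cases F) auto
  obtain g where g: "\<forall>i<rk A. smooth_fun_on (charts A) U (g i)"
      "\<forall>x\<in>U. s x = (\<Sum>i<rk A. g i x *\<^sub>R e i x)"
    using assms(2) F(2) unfolding sections_def smooth_section_on_def by fastforce
  have "open U" using vector_bundle F(2) unfolding vector_bundle_def by blast
  moreover have "smooth_fun_on (charts A) U f"
    using assms(1) by (auto simp: Cinf_def intro: smooth_fun_on_subset)
  ultimately have "\<exists>g. (\<forall>i<rk A. smooth_fun_on (charts A) U (g i)) \<and>
      (\<forall>x\<in>U. (f \<odot> s) x = (\<Sum>i<rk A. g i x *\<^sub>R e i x))"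
    using g
    by (intro exI[of _ "\<lambda>i x. f x * g i x"])
      (auto simp: fmul_def scaleR_sum_right intro: smooth_fun_on_mult atlas)
  then show "case F of (U, e) \<Rightarrow> \<exists>g. (\<forall>i<rk A. smooth_fun_on (charts A) U (g i)) \<and>
      (\<forall>x\<in>U. (f \<odot> s) x = (\<Sum>i<rk A. g i x *\<^sub>R e i x))"
    using F(1) by simp
qed

lemma section_zero: "0 \<in> \<Gamma>"
  unfolding sections_def smooth_section_on_def mem_Collect_eq
proof (intro conjI ballI)
  show "0 x \<in> fibre A x" for x
    by (simp add: subspace_0 subspace_fibre)
  have "smooth_fun_on (charts A) W (\<lambda>x. 0)" for W
    using const_in_Cinf[of 0 "charts A"] by (auto simp: Cinf_def intro: smooth_fun_on_subset)
  then show "case F of (U, e) \<Rightarrow> \<exists>g. (\<forall>i<rk A. smooth_fun_on (charts A) (U \<inter> UNIV) (g i)) \<and>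
      (\<forall>x\<in>U \<inter> UNIV. 0 x = (\<Sum>i<rk A. g i x *\<^sub>R e i x))" if "F \<in> frames A" for F
    using that by (cases F) (auto intro!: exI[of _ "\<lambda>i x. 0"])
qed

lemma subsection_section: "s \<in> \<Gamma>k \<Longrightarrow> s \<in> \<Gamma>"
  by (simp add: subsections_def)

lemma subsection_zero: "0 \<in> \<Gamma>k"
  by (simp add: subsections_def section_zero subspace_0 subspace_ideal)

lemma subsection_add: "s \<in> \<Gamma>k \<Longrightarrow> t \<in> \<Gamma>k \<Longrightarrow> s + t \<in> \<Gamma>k"
  by (simp add: subsections_def section_add subspace_add subspace_ideal)

lemma subsection_fmul: "f \<in> Cinf (charts A) \<Longrightarrow> s \<in> \<Gamma>k \<Longrightarrow> f \<odot> s \<in> \<Gamma>k"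
  by (simp add: subsections_def section_fmul) (simp add: fmul_def subspace_scale subspace_ideal)

lemma section_scaleR: "s \<in> \<Gamma> \<Longrightarrow> r *\<^sub>R s \<in> \<Gamma>"
  using section_fmul[OF const_in_Cinf[of r], of s] by (simp add: const_fmul)

lemma subsection_scaleR: "s \<in> \<Gamma>k \<Longrightarrow> r *\<^sub>R s \<in> \<Gamma>k"
  using subsection_fmul[OF const_in_Cinf[of r], of s] by (simp add: const_fmul)

lemma section_diff: "s \<in> \<Gamma> \<Longrightarrow> t \<in> \<Gamma> \<Longrightarrow> s - t \<in> \<Gamma>"
  using section_add[of s "(-1) *\<^sub>R t"] section_scaleR[of t "-1"] by simp

lemma subsection_uminus: "s \<in> \<Gamma>k \<Longrightarrow> - s \<in> \<Gamma>k"
  using subsection_scaleR[of s "-1"] by simp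

lemma subsection_diff: "s \<in> \<Gamma>k \<Longrightarrow> t \<in> \<Gamma>k \<Longrightarrow> s - t \<in> \<Gamma>k"
  using subsection_add[of s "- t"] subsection_uminus[of t] by simp

lemma bracket_section: "\<alpha> \<in> \<Gamma> \<Longrightarrow> \<beta> \<in> \<Gamma> \<Longrightarrow> br \<alpha> \<beta> \<in> \<Gamma>"
  using lie_algebroid unfolding lie_algebroid_def by blast

lemma bracket_skew: "\<alpha> \<in> \<Gamma> \<Longrightarrow> \<beta> \<in> \<Gamma> \<Longrightarrow> br \<alpha> \<beta> = - br \<beta> \<alpha>"
  using lie_algebroid unfolding lie_algebroid_def by blast

lemma bracket_lincomb:
  "\<alpha> \<in> \<Gamma> \<Longrightarrow> \<beta> \<in> \<Gamma> \<Longrightarrow> \<gamma> \<in> \<Gamma> \<Longrightarrow> br \<alpha> (s *\<^sub>R \<beta> + t *\<^sub>R \<gamma>) = s *\<^sub>R br \<alpha> \<beta> + t *\<^sub>R br \<alpha> \<gamma>"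
  using lie_algebroid unfolding lie_algebroid_def by blast

lemma bracket_diff: "\<alpha> \<in> \<Gamma> \<Longrightarrow> \<beta> \<in> \<Gamma> \<Longrightarrow> \<gamma> \<in> \<Gamma> \<Longrightarrow> br \<alpha> (\<beta> - \<gamma>) = br \<alpha> \<beta> - br \<alpha> \<gamma>"
  using bracket_lincomb[of \<alpha> \<beta> \<gamma> 1 "-1"] by simp

lemma bracket_uminus: "\<alpha> \<in> \<Gamma> \<Longrightarrow> \<beta> \<in> \<Gamma> \<Longrightarrow> br \<alpha> (- \<beta>) = - br \<alpha> \<beta>"
  using bracket_lincomb[of \<alpha> \<beta> \<beta> "-1" 0] by simp

lemma bracket_zero: "\<alpha> \<in> \<Gamma> \<Longrightarrow> br \<alpha> 0 = 0"
  using bracket_lincomb[of \<alpha> \<alpha> \<alpha> 0 0] by simp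

lemma bracket_ideal: "\<alpha> \<in> \<Gamma> \<Longrightarrow> \<xi> \<in> \<Gamma>k \<Longrightarrow> br \<alpha> \<xi> \<in> \<Gamma>k"
  using bundle_of_ideals unfolding bundle_of_ideals_def by blast

lemma rho_ideal: "\<xi> \<in> \<Gamma>k \<Longrightarrow> rho A \<xi> = 0"
  using bundle_of_ideals by (auto simp: rho_def bundle_of_ideals_def subsections_def fun_eq_iff)

section \<open>Forms\<close>

text \<open>A tangent vector kills the function \<open>0\<close>, by linearity. Together with \<open>rho_ideal\<close> this removes
  the terms \<open>[\<rho> \<xi>, X]\<close> from Lie derivatives along \<open>\<xi> \<in> \<Gamma>(\<kk>)\<close>.\<close>

lemma vbracket_zero:
  assumes "X \<in> VF" shows "vbracket (charts A) 0 X = 0"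
proof -
  have "X x 0 = 0" for x
  proof -
    have "X x \<in> tangent (charts A) x" using assms by (simp add: vfields_def)
    moreover have "(\<lambda>x. 0) \<in> Cinf (charts A)" by (rule const_in_Cinf)
    ultimately have "X x (0 *\<^sub>R (\<lambda>x. 0) + 0 *\<^sub>R (\<lambda>x. 0)) = 0 * X x (\<lambda>x. 0) + 0 * X x (\<lambda>x. 0)"
      unfolding tangent_def by blast
    then show ?thesis by simp
  qed
  moreover have "vapp 0 f = 0" for f :: "'m \<Rightarrow> real" by (rule ext) (simp add: vapp_def)
  ultimately show ?thesis by (intro ext) (simp add: vbracket_def)
qed

text \<open>A form takes values in \<open>\<Gamma>(\<kk>)\<close> on arbitrary lists, by its default value 0. Hence the identities
  below hold for \<open>[\<rho> \<alpha>, X]\<close> as an argument even before one knows that it is a vector field.\<close>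

lemma Omega_value: "\<omega> \<in> Omega A \<kk> q \<Longrightarrow> \<omega> Xs \<in> \<Gamma>k"
  unfolding Omega_def using subsection_zero by (cases "length Xs = q \<and> set Xs \<subseteq> VF") auto

lemma Omega_off: "\<omega> \<in> Omega A \<kk> q \<Longrightarrow> \<not> (length Xs = q \<and> set Xs \<subseteq> VF) \<Longrightarrow> \<omega> Xs = 0"
  unfolding Omega_def by blast

lemma Omega1_lincomb:
  assumes "\<omega> \<in> Omega A \<kk> 1" "X \<in> VF" "Y \<in> VF" "f \<in> Cinf (charts A)" "g \<in> Cinf (charts A)"
  shows "\<omega> [f \<odot> X + g \<odot> Y] = f \<odot> \<omega> [X] + g \<odot> \<omega> [Y]"
proof -
  have "\<forall>Xs i. \<forall>X\<in>VF. \<forall>Y\<in>VF. \<forall>f\<in>Cinf (charts A). \<forall>g\<in>Cinf (charts A).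
      length Xs = 1 \<and> set Xs \<subseteq> VF \<and> i < 1 \<longrightarrow>
        \<omega> (Xs[i := f \<odot> X + g \<odot> Y]) = f \<odot> \<omega> (Xs[i := X]) + g \<odot> \<omega> (Xs[i := Y])"
    using assms(1) unfolding Omega_def by blast
  from this[rule_format, OF assms(2-5), of "[X]" 0] show ?thesis using assms(2) by simp
qed

lemma Omega1_zero:
  assumes "\<omega> \<in> Omega A \<kk> 1" shows "\<omega> [0] = 0"
proof (cases "0 \<in> VF")
  case True
  from Omega1_lincomb[OF assms True True const_in_Cinf[of 0] const_in_Cinf[of 0]]
  show ?thesis by (simp add: const_fmul)
next
  case False
  then show ?thesis using Omega_off[OF assms, of "[0]"] by simp
qed

lemma fmul_zero: "f \<odot> 0 = 0"
  by (simp add: fmul_def fun_eq_iff)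

lemma fmul_uminus: "f \<odot> (- s) = - (f \<odot> s)"
  by (simp add: fmul_def fun_eq_iff)

lemma Omega_uminus: "\<omega> \<in> Omega A \<kk> q \<Longrightarrow> - \<omega> \<in> Omega A \<kk> q"
  unfolding Omega_def by (simp add: subsection_uminus fmul_uminus)

lemma Omega_zero: "0 \<in> Omega A \<kk> q"
  unfolding Omega_def by (simp add: subsection_zero fmul_def fun_eq_iff)

lemma form2_eqI:
  assumes "\<And>X Y. X \<in> VF \<Longrightarrow> Y \<in> VF \<Longrightarrow> \<omega> [X, Y] = \<eta> [X, Y]"
    and "\<And>Xs. \<not> (length Xs = 2 \<and> set Xs \<subseteq> VF) \<Longrightarrow> \<omega> Xs = \<eta> Xs"
  shows "\<omega> = \<eta>"
proof
  fix Xs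
  show "\<omega> Xs = \<eta> Xs"
  proof (cases "length Xs = 2 \<and> set Xs \<subseteq> VF")
    case True
    then obtain X Y where "Xs = [X, Y]" by (auto elim: length_2E)
    then show ?thesis using True assms(1) by simp
  qed (rule assms(2))
qed

lemma form1_eqI:
  assumes "\<And>X. X \<in> VF \<Longrightarrow> \<omega> [X] = \<eta> [X]"
    and "\<And>Xs. \<not> (length Xs = 1 \<and> set Xs \<subseteq> VF) \<Longrightarrow> \<omega> Xs = \<eta> Xs"
  shows "\<omega> = \<eta>"
proof
  fix Xs
  show "\<omega> Xs = \<eta> Xs"
  proof (cases "length Xs = 1 \<and> set Xs \<subseteq> VF")
    case True
    then obtain X where "Xs = [X]" by (auto simp: length_Suc_conv)
    then show ?thesis using True assms(1) by simp
  qed (rule assms(2))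
qed

lemma lie_der_off:
  assumes "\<alpha> \<in> \<Gamma>" "\<omega> \<in> Omega A \<kk> q" "\<not> (length Xs = q \<and> set Xs \<subseteq> VF)"
  shows "lie_der A \<alpha> \<omega> Xs = 0"
proof (cases "set Xs \<subseteq> VF")
  case True
  then have len: "length Xs \<noteq> q" using assms(3) by simp
  then have "\<omega> Ys = 0" if "length Ys = length Xs" for Ys
    using Omega_off[OF assms(2)] that by simp
  then show ?thesis by (simp add: lie_der_def bracket_zero assms(1))
qed (simp add: lie_der_def)

lemma im_form1_forms:
  assumes "(c0, c1) \<in> im_forms A \<kk> 1"
  shows "c0 \<alpha> \<in> Omega A \<kk> 1" "c1 \<alpha> \<in> Omega A \<kk> 0"
proof -
  have "\<forall>\<alpha>\<in>\<Gamma>. c0 \<alpha> \<in> Omega A \<kk> 1" "\<forall>\<alpha>\<in>\<Gamma>. c1 \<alpha> \<in> Omega A \<kk> 0"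
    "\<forall>\<alpha>. \<alpha> \<notin> \<Gamma> \<longrightarrow> c0 \<alpha> = 0 \<and> c1 \<alpha> = 0"
    using assms unfolding im_forms_def by auto
  then show "c0 \<alpha> \<in> Omega A \<kk> 1" "c1 \<alpha> \<in> Omega A \<kk> 0"
    using Omega_zero by metis+
qed

section \<open>The horizontal derivative in degree one\<close>

text \<open>These are the only properties of \<open>(C, v)\<close> and \<open>(c\<^sub>0, c\<^sub>1)\<close> behind the pointwise formula for
  \<open>D\<close>. Sums and multiples inherit them at once, so the formula applies along the whole line
  \<open>(C, v) + r (L, l)\<close>.\<close>

definition degree_one_pair ::
    "(('m \<Rightarrow> 'a) \<Rightarrow> ('m, 'a) form) \<Rightarrow> (('m \<Rightarrow> 'a) \<Rightarrow> ('m, 'a) form) \<Rightarrow> bool" where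
  "degree_one_pair c0 c1 \<longleftrightarrow>
     (\<forall>\<alpha> Xs. \<not> (length Xs = 1 \<and> set Xs \<subseteq> VF) \<longrightarrow> c0 \<alpha> Xs = 0) \<and>
     (\<forall>\<alpha> Xs. Xs \<noteq> [] \<longrightarrow> c1 \<alpha> Xs = 0) \<and> c0 0 = 0 \<and> c1 0 = 0"

lemma degree_one_pair_add_scaleR:
  "degree_one_pair c0 c1 \<Longrightarrow> degree_one_pair d0 d1
    \<Longrightarrow> degree_one_pair (c0 + r *\<^sub>R d0) (c1 + r *\<^sub>R d1)"
  by (simp add: degree_one_pair_def scaleR_fun_apply)

lemma length_omit: "i < length Xs \<Longrightarrow> length (omit i Xs) = length Xs - 1"
  by (simp add: omit_def)

text \<open>A form \<open>\<eta>\<close> of degree 0 is the section \<open>\<eta> []\<close>, and its exterior covariant derivative is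
  \<open>X \<mapsto> \<nabla>\<^sub>X (\<eta> [])\<close>, that is \<open>C (\<eta> [])\<close>.\<close>

lemma dnabla_0form:
  assumes "degree_one_pair C v" and \<eta>: "\<And>Xs. Xs \<noteq> [] \<Longrightarrow> \<eta> Xs = 0"
  shows "dnabla A (nabla (C, v)) \<eta> = C (\<eta> [])"
proof
  fix Xs
  have C: "C 0 = 0" "\<not> (length Xs = 1 \<and> set Xs \<subseteq> VF) \<Longrightarrow> C \<xi> Xs = 0" for \<xi>
    using assms(1) by (auto simp: degree_one_pair_def)
  show "dnabla A (nabla (C, v)) \<eta> Xs = C (\<eta> []) Xs"
  proof (cases "length Xs = 1 \<and> set Xs \<subseteq> VF")
    case True
    then obtain X where "Xs = [X]" by (auto simp: length_Suc_conv)
    then show ?thesis using True by (simp add: dnabla_def nabla_def omit_def)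
  next
    case False
    have "\<eta> (omit i Xs) = 0" if "i < length Xs" "length Xs \<noteq> 1" for i
      using that length_omit[OF that(1)] by (intro \<eta>) auto
    then show ?thesis using False C by (auto simp: dnabla_def nabla_def \<eta>)
  qed
qed

lemma dnabla1_degree_one:
  assumes "degree_one_pair C v" "degree_one_pair c0 c1"
  shows "dnabla1 A (C, v) (c0, c1) \<beta> = c0 \<beta> - C (c1 \<beta> [])"
  using assms(2) by (simp add: dnabla1_def dnabla_0form[OF assms(1)] degree_one_pair_def)

lemma hor_ext_der_snd:
  assumes "degree_one_pair C v" "degree_one_pair c0 c1"
  shows "snd (hor_ext_der A (C, v) (c0, c1)) \<beta>
    = c0 (\<beta> - v \<beta> []) - C (c1 (\<beta> - v \<beta> []) [])"
  by (simp add: hor_ext_der_def hproj_def dnabla1_degree_one[OF assms])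

lemma hor_ext_der_fst:
  assumes "degree_one_pair C v" "degree_one_pair c0 c1" "X \<in> VF" "Y \<in> VF"
  shows "fst (hor_ext_der A (C, v) (c0, c1)) \<alpha> [X, Y]
    = C (c0 \<alpha> [Y]) [X] - C (c0 \<alpha> [X]) [Y] - c0 \<alpha> [vbracket (charts A) X Y]
      - (c0 (C \<alpha> [X]) [Y] - C (c1 (C \<alpha> [X]) []) [Y])
      + (c0 (C \<alpha> [Y]) [X] - C (c1 (C \<alpha> [Y]) []) [X])"
  using assms(3,4)
  by (simp add: hor_ext_der_def dnabla1_degree_one[OF assms(1,2)] dnabla_def nabla_def omit_def
      numeral_2_eq_2)

text \<open>Two IM forms are equal only if they agree on all lists, so the vanishing of \<open>D\<close> off pairs of
  vector fields is part of the expansion. On a list of length other than 2 every summand evaluates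
  a form of degree 1 on a list of the wrong length.\<close>

lemma hor_ext_der_off:
  assumes "degree_one_pair C v" "degree_one_pair c0 c1" "\<not> (length Xs = 2 \<and> set Xs \<subseteq> VF)"
  shows "fst (hor_ext_der A (C, v) (c0, c1)) \<alpha> Xs = 0"
proof -
  have zero: "C 0 = 0" "c0 0 = 0" "c1 0 = 0"
    and off: "length Zs \<noteq> 1 \<or> \<not> set Zs \<subseteq> VF \<Longrightarrow> C \<xi> Zs = 0"
      "length Zs \<noteq> 1 \<or> \<not> set Zs \<subseteq> VF \<Longrightarrow> c0 \<xi> Zs = 0" for Zs \<xi>
    using assms(1,2) by (auto simp: degree_one_pair_def)
  show ?thesis
  proof (cases "length Xs = 2")
    case True
    then obtain X Y where "Xs = [X, Y]" by (rule length_2E)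
    moreover from this have "X \<notin> VF \<or> Y \<notin> VF" using assms(3) by auto
    ultimately show ?thesis
      by (auto simp: hor_ext_der_def dnabla1_degree_one[OF assms(1,2)] dnabla_def omit_def off zero)
  next
    case False
    have 1: "length (omit i Xs) \<noteq> 1" if "i < length Xs" for i
      using False length_omit[OF that] that by simp
    have 2: "length (Z # omit i (omit j Xs)) \<noteq> 1" if "j < length Xs" "i < j" for i j Z
      using that length_omit[of j Xs] length_omit[of i "omit j Xs"] False by simp
    have "(\<Sum>i<length Xs. (-1) ^ i *\<^sub>R nabla (C, v) (Xs ! i) (c0 \<alpha> (omit i Xs))) = 0"
      using 1 by (intro sum.neutral) (simp add: nabla_def off zero)
    moreover have "(\<Sum>j<length Xs. \<Sum>i<j. (-1) ^ (i + j) *\<^sub>R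
        c0 \<alpha> (vbracket (charts A) (Xs ! i) (Xs ! j) # omit i (omit j Xs))) = 0"
      using 2 by (intro sum.neutral ballI) (subst off(2), auto)
    moreover have "(\<Sum>i<length Xs. (-1) ^ i *\<^sub>R
        (c0 (C \<alpha> [Xs ! i]) - C (c1 (C \<alpha> [Xs ! i]) [])) (omit i Xs)) = 0"
      using 1 by (intro sum.neutral) (simp add: off)
    ultimately show ?thesis
      by (simp add: hor_ext_der_def dnabla1_degree_one[OF assms(1,2)] dnabla_def)
  qed
qed

end

section \<open>IM forms of degree one\<close>

locale im_one_form = ideal_bundle A \<kk>
  for A :: "('m::{t2_space, second_countable_topology}, 'e::real_normed_vector, 'a::real_vector) algebroid"
    and \<kk> :: "'m \<Rightarrow> 'a set" +
  fixes L l :: "('m \<Rightarrow> 'a) \<Rightarrow> ('m, 'a) form"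
  assumes im_form: "(L, l) \<in> im_forms A \<kk> 1"
begin

lemmas L_Omega = im_form1_forms(1)[OF im_form]
  and l_Omega = im_form1_forms(2)[OF im_form]

lemma L_value: "L \<alpha> Xs \<in> \<Gamma>k"
  by (rule Omega_value[OF L_Omega])

lemma l_value: "l \<alpha> Xs \<in> \<Gamma>k"
  by (rule Omega_value[OF l_Omega])

lemma L_value_section: "L \<alpha> Xs \<in> \<Gamma>" and l_value_section: "l \<alpha> Xs \<in> \<Gamma>"
  using L_value l_value subsection_section by blast+

lemma L_off_sections: "\<alpha> \<notin> \<Gamma> \<Longrightarrow> L \<alpha> = 0" and l_off_sections: "\<alpha> \<notin> \<Gamma> \<Longrightarrow> l \<alpha> = 0"
  using im_form unfolding im_forms_def by auto

lemma L_lincomb: "\<alpha> \<in> \<Gamma> \<Longrightarrow> \<beta> \<in> \<Gamma> \<Longrightarrow> L (s *\<^sub>R \<alpha> + t *\<^sub>R \<beta>) = s *\<^sub>R L \<alpha> + t *\<^sub>R L \<beta>"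
  using im_form unfolding im_forms_def by auto

lemma L_add: "\<alpha> \<in> \<Gamma> \<Longrightarrow> \<beta> \<in> \<Gamma> \<Longrightarrow> L (\<alpha> + \<beta>) = L \<alpha> + L \<beta>"
  using L_lincomb[of \<alpha> \<beta> 1 1] by simp

lemma L_diff: "\<alpha> \<in> \<Gamma> \<Longrightarrow> \<beta> \<in> \<Gamma> \<Longrightarrow> L (\<alpha> - \<beta>) = L \<alpha> - L \<beta>"
  using L_lincomb[of \<alpha> \<beta> 1 "-1"] by simp

lemma L_scaleR: "\<alpha> \<in> \<Gamma> \<Longrightarrow> L (s *\<^sub>R \<alpha>) = s *\<^sub>R L \<alpha>"
  using L_lincomb[of \<alpha> \<alpha> s 0] by simp

lemma L_zero: "L 0 = 0"
  using L_scaleR[OF section_zero, of 0] by simp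

lemma l_lincomb:
  "\<alpha> \<in> \<Gamma> \<Longrightarrow> \<beta> \<in> \<Gamma> \<Longrightarrow> f \<in> Cinf (charts A) \<Longrightarrow> g \<in> Cinf (charts A)
    \<Longrightarrow> l (f \<odot> \<alpha> + g \<odot> \<beta>) = fform f (l \<alpha>) + fform g (l \<beta>)"
  using im_form unfolding im_forms_def by auto

lemma L_fmul: "\<alpha> \<in> \<Gamma> \<Longrightarrow> f \<in> Cinf (charts A) \<Longrightarrow> L (f \<odot> \<alpha>) = fform f (L \<alpha>) + d_wedge A f (l \<alpha>)"
  using im_form unfolding im_forms_def by auto

lemma L_bracket: "\<alpha> \<in> \<Gamma> \<Longrightarrow> \<beta> \<in> \<Gamma> \<Longrightarrow> L (br \<alpha> \<beta>) = lie_der A \<alpha> (L \<beta>) - lie_der A \<beta> (L \<alpha>)"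
  using im_form unfolding im_forms_def by auto

lemma l_bracket:
  "\<alpha> \<in> \<Gamma> \<Longrightarrow> \<beta> \<in> \<Gamma> \<Longrightarrow> l (br \<alpha> \<beta>) = lie_der A \<alpha> (l \<beta>) - interior_prod (rho A \<beta>) (L \<alpha>)"
  using im_form unfolding im_forms_def by auto

lemma L_fmul_section:
  assumes "\<alpha> \<in> \<Gamma>" "f \<in> Cinf (charts A)" "X \<in> VF"
  shows "L (f \<odot> \<alpha>) [X] = f \<odot> L \<alpha> [X] + vapp X f \<odot> l \<alpha> []"
  using assms by (simp add: L_fmul fform_def d_wedge_def omit_def)

lemma L_bracket_apply:
  assumes "\<alpha> \<in> \<Gamma>" "\<beta> \<in> \<Gamma>" "X \<in> VF"
  shows "L (br \<alpha> \<beta>) [X] = br \<alpha> (L \<beta> [X]) - L \<beta> [vbracket (charts A) (rho A \<alpha>) X]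
    - (br \<beta> (L \<alpha> [X]) - L \<alpha> [vbracket (charts A) (rho A \<beta>) X])"
  using assms by (simp add: L_bracket lie_der_def)

lemma l_bracket_apply:
  assumes "\<alpha> \<in> \<Gamma>" "\<beta> \<in> \<Gamma>"
  shows "l (br \<alpha> \<beta>) [] = br \<alpha> (l \<beta> []) - L \<alpha> [rho A \<beta>]"
  using assms by (simp add: l_bracket lie_der_def interior_prod_def)

lemma L_off: "\<not> (length Xs = 1 \<and> set Xs \<subseteq> VF) \<Longrightarrow> L \<alpha> Xs = 0"
  by (rule Omega_off[OF L_Omega])

lemma fform_const: "fform (\<lambda>x. c) \<omega> = c *\<^sub>R \<omega>"
  by (rule ext) (simp add: fform_def const_fmul scaleR_fun_apply)

lemma l_diff: "\<alpha> \<in> \<Gamma> \<Longrightarrow> \<beta> \<in> \<Gamma> \<Longrightarrow> l (\<alpha> - \<beta>) = l \<alpha> - l \<beta>"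
  using l_lincomb[of \<alpha> \<beta> "\<lambda>x. 1" "\<lambda>x. - 1"] by (simp add: const_in_Cinf const_fmul fform_const)

lemma l_scaleR: "\<alpha> \<in> \<Gamma> \<Longrightarrow> l (s *\<^sub>R \<alpha>) = s *\<^sub>R l \<alpha>"
  using l_lincomb[of \<alpha> \<alpha> "\<lambda>x. s" "\<lambda>x. 0"] by (simp add: const_in_Cinf const_fmul fform_const)

lemma l_zero: "l 0 = 0"
  using l_scaleR[OF section_zero, of 0] by simp

lemma l_off: "Xs \<noteq> [] \<Longrightarrow> l \<alpha> Xs = 0"
  by (rule Omega_off[OF l_Omega]) simp

lemma degree_one: "degree_one_pair L l"
  by (simp add: degree_one_pair_def L_off l_off L_zero l_zero)

end

section \<open>Horizontal forms of degree one\<close>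

locale horizontal_form = im_one_form A \<kk> L l
  for A :: "('m::{t2_space, second_countable_topology}, 'e::real_normed_vector, 'a::real_vector) algebroid"
    and \<kk> :: "'m \<Rightarrow> 'a set"
    and L l :: "('m \<Rightarrow> 'a) \<Rightarrow> ('m, 'a) form" +
  assumes l_ideal: "\<xi> \<in> \<Gamma>k \<Longrightarrow> l \<xi> = 0"
begin

text \<open>The obstruction to \<open>C\<^sup>\<infinity>(M)\<close>-linearity of \<open>L\<close> is \<open>df \<and> l \<xi>\<close>, which vanishes on \<open>\<Gamma>(\<kk>)\<close>.\<close>

lemma L_fmul_ideal:
  assumes "\<xi> \<in> \<Gamma>k" "f \<in> Cinf (charts A)"
  shows "L (f \<odot> \<xi>) = fform f (L \<xi>)"
proof -
  have "d_wedge A f 0 = 0" by (rule ext) (simp add: d_wedge_def fmul_zero)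
  then show ?thesis using assms by (simp add: L_fmul subsection_section l_ideal)
qed

lemma L_lincomb_ideal:
  assumes "\<xi> \<in> \<Gamma>k" "\<eta> \<in> \<Gamma>k" "f \<in> Cinf (charts A)" "g \<in> Cinf (charts A)"
  shows "L (f \<odot> \<xi> + g \<odot> \<eta>) = fform f (L \<xi>) + fform g (L \<eta>)"
  using assms by (simp add: L_add section_fmul subsection_section L_fmul_ideal)

text \<open>The Lie derivative along \<open>\<xi>\<close> reduces to the bracket with \<open>\<xi>\<close>, because the anchor kills \<open>\<xi>\<close>.\<close>

lemma L_bracket_ideal:
  assumes "\<alpha> \<in> \<Gamma>" "\<xi> \<in> \<Gamma>k" "X \<in> VF"
  shows "L (br \<alpha> \<xi>) [X]
    = br \<alpha> (L \<xi> [X]) - L \<xi> [vbracket (charts A) (rho A \<alpha>) X] - br \<xi> (L \<alpha> [X])"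
  using assms
  by (simp add: L_bracket_apply subsection_section rho_ideal vbracket_zero Omega1_zero[OF L_Omega])

text \<open>The bracket \<open>[\<xi>, \<beta>]\<close> lies in \<open>\<Gamma>(\<kk>)\<close>, so \<open>l [\<xi>, \<beta>] = 0\<close>; the IM equation for \<open>l [\<xi>, \<beta>]\<close> then
  expresses the bracket of \<open>\<xi>\<close> with \<open>l \<beta>\<close> through \<open>L\<close>.\<close>

lemma bracket_l_value:
  assumes "\<xi> \<in> \<Gamma>k" "\<beta> \<in> \<Gamma>"
  shows "br (l \<beta> []) \<xi> = - L \<xi> [rho A \<beta>]"
proof -
  have "br \<xi> \<beta> = - br \<beta> \<xi>" using assms by (simp add: bracket_skew[of \<xi>] subsection_section)
  then have "br \<xi> \<beta> \<in> \<Gamma>k" using assms bracket_ideal subsection_uminus by simp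
  then have "l (br \<xi> \<beta>) [] = 0" by (simp add: l_ideal)
  then have "br \<xi> (l \<beta> []) = L \<xi> [rho A \<beta>]"
    using l_bracket_apply[of \<xi> \<beta>] assms by (simp add: subsection_section)
  then show ?thesis
    using bracket_skew[of "l \<beta> []" \<xi>] assms l_value_section by (simp add: subsection_section)
qed

section \<open>The quadratic map\<close>

definition Q0 :: "('m \<Rightarrow> 'a) \<Rightarrow> ('m, 'a) form" where "Q0 = fst (c2 (L, l))"
definition Q1 :: "('m \<Rightarrow> 'a) \<Rightarrow> ('m, 'a) form" where "Q1 = snd (c2 (L, l))"

lemma Q0_apply: "Q0 \<alpha> [X, Y] = L (L \<alpha> [Y]) [X] - L (L \<alpha> [X]) [Y]"
  by (simp add: Q0_def c2_def dot_wedge_def)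

lemma Q1_eq: "Q1 \<alpha> = - L (l \<alpha> [])"
  by (simp add: Q1_def c2_def dot_def)

lemma Q0_off:
  assumes "\<not> (length Xs = 2 \<and> set Xs \<subseteq> VF)" shows "Q0 \<alpha> Xs = 0"
proof (cases "length Xs = 2")
  case True
  then obtain X Y where "Xs = [X, Y]" by (rule length_2E)
  with assms have "Xs = [X, Y]" "X \<notin> VF \<or> Y \<notin> VF" by auto
  then show ?thesis by (auto simp: Q0_apply L_off L_zero)
next
  case False
  then show ?thesis by (auto simp: Q0_def c2_def dot_wedge_def split: list.split)
qed

lemma Q0_Omega: "Q0 \<alpha> \<in> Omega A \<kk> 2"
proof -
  have val: "Q0 \<alpha> Xs \<in> \<Gamma>k" if len: "length Xs = 2" for Xs
  proof -
    obtain X Y where "Xs = [X, Y]" using len by (rule length_2E)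
    then show ?thesis by (simp add: Q0_apply subsection_diff L_value)
  qed
  have lin: "Q0 \<alpha> (Xs[i := f \<odot> X + g \<odot> Y]) = f \<odot> Q0 \<alpha> (Xs[i := X]) + g \<odot> Q0 \<alpha> (Xs[i := Y])"
    if "X \<in> VF" "Y \<in> VF" "f \<in> Cinf (charts A)" "g \<in> Cinf (charts A)" "length Xs = 2" "i < 2"
    for Xs i X Y f g
  proof -
    obtain Z W where Xs: "Xs = [Z, W]" using \<open>length Xs = 2\<close> by (rule length_2E)
    have *: "L \<beta> [f \<odot> X + g \<odot> Y] = f \<odot> L \<beta> [X] + g \<odot> L \<beta> [Y]" for \<beta>
      by (rule Omega1_lincomb[OF L_Omega that(1-4)])
    have "i = 0 \<or> i = 1" using \<open>i < 2\<close> by auto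
    then show ?thesis
      by (auto simp: Xs Q0_apply * L_lincomb_ideal L_value that fform_def)
        (simp_all add: fmul_def fun_eq_iff algebra_simps)
  qed
  have alt: "Q0 \<alpha> Xs = 0" if "length Xs = 2" "i < j" "j < 2" "Xs ! i = Xs ! j" for Xs i j
  proof -
    obtain Z W where Xs: "Xs = [Z, W]" using \<open>length Xs = 2\<close> by (rule length_2E)
    have ij: "i = 0" "j = 1" using that(2,3) by auto
    have "Z = W" using that(4) unfolding ij Xs by simp
    then show ?thesis by (simp add: Xs Q0_apply)
  qed
  show ?thesis
    unfolding Omega_def mem_Collect_eq
    by (intro conjI allI ballI impI) (blast intro: val Q0_off lin alt)+
qed

lemma Q1_Omega: "Q1 \<alpha> \<in> Omega A \<kk> 1"
  unfolding Q1_eq by (rule Omega_uminus[OF L_Omega])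

lemma Q0_lincomb:
  assumes "\<alpha> \<in> \<Gamma>" "\<beta> \<in> \<Gamma>"
  shows "Q0 (s *\<^sub>R \<alpha> + t *\<^sub>R \<beta>) = s *\<^sub>R Q0 \<alpha> + t *\<^sub>R Q0 \<beta>"
proof (rule form2_eqI)
  fix X Y
  show "Q0 (s *\<^sub>R \<alpha> + t *\<^sub>R \<beta>) [X, Y] = (s *\<^sub>R Q0 \<alpha> + t *\<^sub>R Q0 \<beta>) [X, Y]"
    by (simp add: Q0_apply scaleR_fun_apply L_lincomb assms L_value_section)
      (simp add: algebra_simps)
qed (simp add: Q0_off scaleR_fun_apply)

lemma Q1_lincomb:
  assumes "\<alpha> \<in> \<Gamma>" "\<beta> \<in> \<Gamma>" "f \<in> Cinf (charts A)" "g \<in> Cinf (charts A)"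
  shows "Q1 (f \<odot> \<alpha> + g \<odot> \<beta>) = fform f (Q1 \<alpha>) + fform g (Q1 \<beta>)"
proof -
  have "l (f \<odot> \<alpha> + g \<odot> \<beta>) [] = f \<odot> l \<alpha> [] + g \<odot> l \<beta> []"
    by (simp add: l_lincomb assms fform_def)
  then show ?thesis
    by (simp add: Q1_eq L_lincomb_ideal l_value assms) (simp add: fform_def fmul_uminus fun_eq_iff)
qed

lemma Q0_fmul:
  assumes "\<alpha> \<in> \<Gamma>" "f \<in> Cinf (charts A)"
  shows "Q0 (f \<odot> \<alpha>) = fform f (Q0 \<alpha>) + d_wedge A f (Q1 \<alpha>)"
proof (rule form2_eqI)
  fix X Y assume XY: "X \<in> VF" "Y \<in> VF"
  have smooth: "vapp Z f \<in> Cinf (charts A)" if "Z \<in> VF" for Z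
    using that assms(2) by (simp add: vfields_def)
  have "L (L (f \<odot> \<alpha>) [Y]) [X] = f \<odot> L (L \<alpha> [Y]) [X] + vapp Y f \<odot> L (l \<alpha> []) [X]"
    "L (L (f \<odot> \<alpha>) [X]) [Y] = f \<odot> L (L \<alpha> [X]) [Y] + vapp X f \<odot> L (l \<alpha> []) [Y]"
    using XY smooth by (simp_all add: L_fmul_section assms L_lincomb_ideal L_value l_value fform_def)
  then show "Q0 (f \<odot> \<alpha>) [X, Y] = (fform f (Q0 \<alpha>) + d_wedge A f (Q1 \<alpha>)) [X, Y]"
    using XY
    by (simp add: Q0_apply Q1_eq fform_def d_wedge_def omit_def numeral_2_eq_2)
      (simp add: fmul_def fun_eq_iff algebra_simps)
next
  fix Xs assume off: "\<not> (length Xs = 2 \<and> set Xs \<subseteq> VF)"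
  have "d_wedge A f (Q1 \<alpha>) Xs = 0"
  proof (cases "set Xs \<subseteq> VF")
    case True
    then have "Q1 \<alpha> (omit i Xs) = 0" if "i < length Xs" for i
      using that off by (intro Omega_off[OF Q1_Omega]) (auto simp: omit_def)
    then show ?thesis by (simp add: d_wedge_def fmul_zero)
  qed (simp add: d_wedge_def)
  then show "Q0 (f \<odot> \<alpha>) Xs = (fform f (Q0 \<alpha>) + d_wedge A f (Q1 \<alpha>)) Xs"
    using off by (simp add: Q0_off fform_def fmul_zero)
qed

text \<open>Applying \<open>L_bracket_ideal\<close> to the sections \<open>L \<alpha> (Z)\<close> and \<open>L \<beta> (Z)\<close> of \<open>\<kk>\<close> produces the terms of the
  two Lie derivatives and, besides them, brackets of a value of \<open>L \<alpha>\<close> with a value of \<open>L \<beta>\<close>. Those are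
  symmetric in the two vector fields and drop out of the difference that defines \<open>Q0\<close>.\<close>

lemma Q0_bracket:
  assumes \<alpha>: "\<alpha> \<in> \<Gamma>" and \<beta>: "\<beta> \<in> \<Gamma>"
  shows "Q0 (br \<alpha> \<beta>) = lie_der A \<alpha> (Q0 \<beta>) - lie_der A \<beta> (Q0 \<alpha>)"
proof (rule form2_eqI)
  fix X Y assume XY: "X \<in> VF" "Y \<in> VF"
  let ?ad = "\<lambda>\<gamma> Z. vbracket (charts A) (rho A \<gamma>) Z"
  have LL: "L (L (br \<alpha> \<beta>) [Z]) [W]
      = br \<alpha> (L (L \<beta> [Z]) [W]) - L (L \<beta> [Z]) [?ad \<alpha> W] - br (L \<beta> [Z]) (L \<alpha> [W])
        - L (L \<beta> [?ad \<alpha> Z]) [W]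
        - (br \<beta> (L (L \<alpha> [Z]) [W]) - L (L \<alpha> [Z]) [?ad \<beta> W] - br (L \<alpha> [Z]) (L \<beta> [W])
          - L (L \<alpha> [?ad \<beta> Z]) [W])" if "Z \<in> VF" "W \<in> VF" for Z W
    using that
    by (simp add: L_bracket_apply[OF \<alpha> \<beta>] \<alpha> \<beta> L_diff section_diff bracket_section
        L_value_section L_bracket_ideal L_value)
  have skew: "br (L \<beta> [Z]) (L \<alpha> [W]) = - br (L \<alpha> [W]) (L \<beta> [Z])" for Z W
    by (rule bracket_skew[OF L_value_section L_value_section])
  show "Q0 (br \<alpha> \<beta>) [X, Y] = (lie_der A \<alpha> (Q0 \<beta>) - lie_der A \<beta> (Q0 \<alpha>)) [X, Y]"
    using XY
    by (simp add: Q0_apply lie_der_def numeral_2_eq_2 LL skew bracket_diff \<alpha> \<beta> L_value_section)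
next
  fix Xs assume "\<not> (length Xs = 2 \<and> set Xs \<subseteq> VF)"
  then show "Q0 (br \<alpha> \<beta>) Xs = (lie_der A \<alpha> (Q0 \<beta>) - lie_der A \<beta> (Q0 \<alpha>)) Xs"
    by (simp add: Q0_off lie_der_off[OF _ Q0_Omega] assms)
qed

text \<open>Expanding \<open>L (l [\<alpha>, \<beta>])\<close> leaves the bracket of \<open>l \<beta>\<close> with \<open>L \<alpha> (X)\<close>, which \<open>bracket_l_value\<close>
  converts into \<open>L (L \<alpha> (X)) (\<rho> \<beta>)\<close>, the missing half of the contraction of \<open>Q0 \<alpha>\<close> with \<open>\<rho> \<beta>\<close>.\<close>

lemma Q1_bracket:
  assumes \<alpha>: "\<alpha> \<in> \<Gamma>" and \<beta>: "\<beta> \<in> \<Gamma>"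
  shows "Q1 (br \<alpha> \<beta>) = lie_der A \<alpha> (Q1 \<beta>) - interior_prod (rho A \<beta>) (Q0 \<alpha>)"
proof (rule form1_eqI)
  fix X assume X: "X \<in> VF"
  have "L (l (br \<alpha> \<beta>) []) [X]
      = br \<alpha> (L (l \<beta> []) [X]) - L (l \<beta> []) [vbracket (charts A) (rho A \<alpha>) X]
        - br (l \<beta> []) (L \<alpha> [X]) - L (L \<alpha> [rho A \<beta>]) [X]"
    using X
    by (simp add: l_bracket_apply \<alpha> \<beta> L_diff bracket_section l_value_section L_value_section
        L_bracket_ideal l_value)
  then show "Q1 (br \<alpha> \<beta>) [X] = (lie_der A \<alpha> (Q1 \<beta>) - interior_prod (rho A \<beta>) (Q0 \<alpha>)) [X]"
    using X
    by (simp add: Q1_eq lie_der_def interior_prod_def Q0_apply bracket_uminus \<alpha> \<beta>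
        L_value_section L_value bracket_l_value)
next
  fix Xs assume off: "\<not> (length Xs = 1 \<and> set Xs \<subseteq> VF)"
  then have "Q0 \<alpha> (rho A \<beta> # Xs) = 0" by (intro Q0_off) auto
  then show "Q1 (br \<alpha> \<beta>) Xs = (lie_der A \<alpha> (Q1 \<beta>) - interior_prod (rho A \<beta>) (Q0 \<alpha>)) Xs"
    using lie_der_off[OF \<alpha> Q1_Omega off] Omega_off[OF Q1_Omega off]
    by (simp add: interior_prod_def)
qed

text \<open>By \<open>bracket_l_value\<close>, both sides are the bracket of \<open>l \<alpha>\<close> and \<open>l \<beta>\<close>.\<close>

lemma Q1_interior_skew:
  assumes "\<alpha> \<in> \<Gamma>" "\<beta> \<in> \<Gamma>"
  shows "interior_prod (rho A \<alpha>) (Q1 \<beta>) = - interior_prod (rho A \<beta>) (Q1 \<alpha>)"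
proof
  fix Xs
  have "L (l \<beta> []) [rho A \<alpha>] = - L (l \<alpha> []) [rho A \<beta>]"
    using bracket_l_value[OF l_value assms(1)] bracket_l_value[OF l_value assms(2)]
      bracket_skew[OF l_value_section l_value_section]
    by (metis minus_minus)
  then have "L (l \<beta> []) (rho A \<alpha> # Xs) = - L (l \<alpha> []) (rho A \<beta> # Xs)"
    by (cases Xs) (simp_all add: L_off)
  then show "interior_prod (rho A \<alpha>) (Q1 \<beta>) Xs = (- interior_prod (rho A \<beta>) (Q1 \<alpha>)) Xs"
    by (simp add: interior_prod_def Q1_eq fun_eq_iff)
qed

lemma c2_horizontal: "c2 (L, l) \<in> hor_im_forms A \<kk> 2"
proof -
  have "(Q0, Q1) \<in> im_forms A \<kk> 2"
    unfolding im_forms_def mem_Collect_eq split_conv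
  proof (intro conjI ballI allI impI)
    show "Q1 \<alpha> \<in> (if (2::nat) = 0 then {0} else Omega A \<kk> (2 - 1))" for \<alpha>
      using Q1_Omega[of \<alpha>] by simp
    show "Q0 \<alpha> = 0" if "\<alpha> \<notin> \<Gamma>" for \<alpha>
      by (rule form2_eqI) (simp_all add: Q0_apply Q0_off L_off_sections[OF that] L_zero)
    show "Q1 \<alpha> = 0" if "\<alpha> \<notin> \<Gamma>" for \<alpha>
      by (simp add: Q1_eq l_off_sections[OF that] L_zero)
  qed (rule Q0_Omega Q0_lincomb Q1_lincomb Q0_fmul Q0_bracket Q1_bracket Q1_interior_skew; assumption)+
  moreover have "Q1 \<xi> = 0" if "\<xi> \<in> \<Gamma>k" for \<xi>
    by (simp add: Q1_eq l_ideal[OF that] L_zero)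
  moreover have "c2 (L, l) = (Q0, Q1)" by (simp add: Q0_def Q1_def)
  ultimately show ?thesis by (simp add: hor_im_forms_def)
qed

lemma c2_homogeneous: "c2 (t *\<^sub>R (L, l)) = t\<^sup>2 *\<^sub>R c2 (L, l)"
proof -
  have "dot_wedge (t *\<^sub>R L) ((t *\<^sub>R L) \<alpha>) = t\<^sup>2 *\<^sub>R dot_wedge L (L \<alpha>)" for \<alpha>
    by (rule ext)
      (auto simp: dot_wedge_def scaleR_fun_apply L_scaleR L_value_section power2_eq_square
        algebra_simps split: list.split)
  moreover have "dot (t *\<^sub>R L) ((t *\<^sub>R l) \<alpha>) = t\<^sup>2 *\<^sub>R dot L (l \<alpha>)" for \<alpha>
    by (intro ext)
      (simp add: dot_def scaleR_fun_apply L_scaleR l_value_section power2_eq_square)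
  ultimately show ?thesis
    by (intro prod_eqI ext) (simp_all add: c2_def scaleR_fun_apply)
qed

section \<open>The curvature along a horizontal line\<close>

text \<open>In the first component the correction terms \<open>(d\<^sup>\<nabla> c)\<^sub>1 (C \<alpha> (X))\<close> vanish for both connections,
  because \<open>v\<close> and \<open>v + r l\<close> are the identity on values of \<open>C + r L\<close>; those of \<open>D (L, l)\<close> match the mixed
  terms \<open>L (C \<alpha> (X))\<close>. In the second, \<open>v + r l\<close> vanishes on the new horizontal part
  \<open>h - r l \<beta>\<close> of \<open>\<beta>\<close>, so that only \<open>(C + r L) (h - r l \<beta>)\<close> is left to expand.\<close>

lemma curvature_expansion:
  assumes connection: "(C, v) \<in> im_connections A \<kk>"
  shows "curvature A ((C, v) + r *\<^sub>R (L, l))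
    = curvature A (C, v) + r *\<^sub>R hor_ext_der A (C, v) (L, l) + r\<^sup>2 *\<^sub>R c2 (L, l)"
proof -
  interpret C: im_one_form A \<kk> C v
    using connection by unfold_locales (simp add: im_connections_def)
  have v_ideal: "v \<xi> [] = \<xi>" if "\<xi> \<in> \<Gamma>k" for \<xi>
    using connection that by (simp add: im_connections_def)
  let ?C = "C + r *\<^sub>R L" and ?v = "v + r *\<^sub>R l"
  have line: "degree_one_pair ?C ?v"
    by (rule degree_one_pair_add_scaleR[OF C.degree_one degree_one])
  have fst_eq: "fst (hor_ext_der A (?C, ?v) (?C, ?v)) \<alpha>
      = fst (hor_ext_der A (C, v) (C, v)) \<alpha> + r *\<^sub>R fst (hor_ext_der A (C, v) (L, l)) \<alpha>
        + r\<^sup>2 *\<^sub>R Q0 \<alpha>" for \<alpha>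
  proof (rule form2_eqI)
    fix X Y assume XY: "X \<in> VF" "Y \<in> VF"
    have ideal: "C \<alpha> [Z] \<in> \<Gamma>k" "L \<alpha> [Z] \<in> \<Gamma>k" "C \<alpha> [Z] + r *\<^sub>R L \<alpha> [Z] \<in> \<Gamma>k" for Z
      by (simp_all add: C.L_value L_value subsection_add subsection_scaleR)
    note sec = subsection_section[OF ideal(1)] subsection_section[OF ideal(2)]
      section_scaleR[OF subsection_section[OF ideal(2)]]
    show "fst (hor_ext_der A (?C, ?v) (?C, ?v)) \<alpha> [X, Y]
      = (fst (hor_ext_der A (C, v) (C, v)) \<alpha> + r *\<^sub>R fst (hor_ext_der A (C, v) (L, l)) \<alpha>
        + r\<^sup>2 *\<^sub>R Q0 \<alpha>) [X, Y]"
      using XY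
      by (simp add: hor_ext_der_fst[OF line line] hor_ext_der_fst[OF C.degree_one C.degree_one]
          hor_ext_der_fst[OF C.degree_one degree_one] Q0_apply scaleR_fun_apply ideal v_ideal l_ideal)
        (simp add: sec L_add L_scaleR C.L_add C.L_scaleR C.L_zero scaleR_fun_apply
          power2_eq_square algebra_simps)
  next
    fix Xs assume "\<not> (length Xs = 2 \<and> set Xs \<subseteq> VF)"
    then show "fst (hor_ext_der A (?C, ?v) (?C, ?v)) \<alpha> Xs
      = (fst (hor_ext_der A (C, v) (C, v)) \<alpha> + r *\<^sub>R fst (hor_ext_der A (C, v) (L, l)) \<alpha>
        + r\<^sup>2 *\<^sub>R Q0 \<alpha>) Xs"
      by (simp add: hor_ext_der_off[OF line line] hor_ext_der_off[OF C.degree_one C.degree_one]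
          hor_ext_der_off[OF C.degree_one degree_one] Q0_off scaleR_fun_apply)
  qed
  have snd_eq: "snd (hor_ext_der A (?C, ?v) (?C, ?v)) \<beta>
      = snd (hor_ext_der A (C, v) (C, v)) \<beta> + r *\<^sub>R snd (hor_ext_der A (C, v) (L, l)) \<beta>
        + r\<^sup>2 *\<^sub>R Q1 \<beta>" for \<beta>
  proof (cases "\<beta> \<in> \<Gamma>")
    case True
    define h where "h = \<beta> - v \<beta> []"
    have h: "h \<in> \<Gamma>" and rl: "r *\<^sub>R l \<beta> [] \<in> \<Gamma>k"
      using True by (auto simp: h_def section_diff C.l_value_section subsection_scaleR l_value)
    have vh: "v h [] = 0" and lh: "l h [] = l \<beta> []"
      using True
      by (simp_all add: h_def C.l_diff l_diff C.l_value_section v_ideal C.l_value l_ideal)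
    have h': "\<beta> - ?v \<beta> [] = h - r *\<^sub>R l \<beta> []"
      by (simp add: h_def scaleR_fun_apply)
    have "?v (h - r *\<^sub>R l \<beta> []) [] = 0"
      using h rl subsection_section[OF rl]
      by (simp add: C.l_diff l_diff vh lh v_ideal[OF rl] l_ideal[OF rl] scaleR_fun_apply)
    then show ?thesis
      using h subsection_section[OF rl]
      unfolding hor_ext_der_snd[OF line line] hor_ext_der_snd[OF C.degree_one C.degree_one]
        hor_ext_der_snd[OF C.degree_one degree_one] h' h_def[symmetric]
      by (simp add: vh lh C.L_zero L_zero scaleR_fun_apply C.L_diff L_diff C.L_scaleR L_scaleR
          l_value_section Q1_eq power2_eq_square algebra_simps)
  next
    case False
    then show ?thesis
      by (simp add: hor_ext_der_snd[OF line line] hor_ext_der_snd[OF C.degree_one C.degree_one]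
          hor_ext_der_snd[OF C.degree_one degree_one] Q1_eq scaleR_fun_apply
          L_off_sections l_off_sections C.L_off_sections C.l_off_sections C.L_zero L_zero)
  qed
  show ?thesis
    unfolding curvature_def
    by (intro prod_eqI ext)
      (simp_all add: fst_eq snd_eq Q0_def Q1_def scaleR_fun_apply)
qed

end

theorem theorem12:
  fixes A :: "('m::{t2_space, second_countable_topology}, 'e::real_normed_vector, 'a::real_vector) algebroid"
    and \<kk> :: "'m \<Rightarrow> 'a set"
    and C v :: "('m \<Rightarrow> 'a) \<Rightarrow> ('m, 'a) form"
  assumes "lie_algebroid A"
    and "bundle_of_ideals A \<kk>"
    and "(C, v) \<in> im_connections A \<kk>"
  shows "c2 \<in> hor_im_forms A \<kk> 1 \<rightarrow> hor_im_forms A \<kk> 2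
    \<and> (\<forall>(L, l)\<in>hor_im_forms A \<kk> 1. \<forall>t::real. c2 (t *\<^sub>R (L, l)) = t\<^sup>2 *\<^sub>R c2 (L, l))
    \<and> (\<forall>(L, l)\<in>hor_im_forms A \<kk> 1. \<forall>lam::real.
         curvature A ((C, v) + lam *\<^sub>R (L, l))
           = curvature A (C, v) + lam *\<^sub>R hor_ext_der A (C, v) (L, l) + lam\<^sup>2 *\<^sub>R c2 (L, l))"
proof -
  have hor: "horizontal_form A \<kk> L l" if "(L, l) \<in> hor_im_forms A \<kk> 1" for L l
    using that assms(1,2) by unfold_locales (auto simp: hor_im_forms_def)
  show ?thesis
    using horizontal_form.c2_horizontal[OF hor] horizontal_form.c2_homogeneous[OF hor]
      horizontal_form.curvature_expansion[OF hor assms(3)]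
    by fast
qed

end
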